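(* Let $a_0,a_1,\alpha,\beta,u,v\in\mathbb{R}$ with $\alpha\beta\neq 0$, $uv\neq 0$ and $|a_0|+|a_1|\neq 0$, and let $(a_{n,k})_{0\le k\le n}$ be the binary binomial interpolated triangle with parameters $(a_0,a_1,\alpha,\beta;u,v)$. Put $\mathcal{B}=u^2\beta-uv\alpha-v^2$. Let $\ell\in\mathbb{Z}$, and let $k_0=0$ if $\ell\ge 0$ and $k_0=|\ell|$ if $\ell<0$. Then the sequence $c_k=a_{2k+\ell,k}$ ($k\ge k_0$) satisfies the binary homogeneous recurrence relation (the same for all $\ell$) $$c_{k+2}=(\alpha^2u+\alpha v+2\beta u)\,c_{k+1}-\beta\mathcal{B}\,c_{k}\qquad\text{for all } k\ge k_0.$$
   Context: The binary binomial interpolated triangle with parameters $(a_0,a_1,\alpha,\beta;u,v)$ is the array of real numbers $a_{n,k}$ ($0\le k\le n$) defined as follows. Its left diagonal is $a_{n,0}=a_n$, where $(a_n)_{n\ge0}$ has initial values $a_0,a_1$ and satisfies $a_n=\alpha a_{n-1}+\beta a_{n-2}$ for $n\ge 2$. The other entries are given by $a_{n,k}=u\,a_{n,k-1}+v\,a_{n-1,k-1}$ for $1\le k\le n$. *)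

theory Defs
  imports Complex_Main
begin

fun left_diagonal :: "real \<Rightarrow> real \<Rightarrow> real \<Rightarrow> real \<Rightarrow> nat \<Rightarrow> real" where
  "left_diagonal a0 a1 \<alpha> \<beta> 0 = a0"
| "left_diagonal a0 a1 \<alpha> \<beta> (Suc 0) = a1"
| "left_diagonal a0 a1 \<alpha> \<beta> (Suc (Suc n)) =
     \<alpha> * left_diagonal a0 a1 \<alpha> \<beta> (Suc n) + \<beta> * left_diagonal a0 a1 \<alpha> \<beta> n"

text \<open>The entry in row \<open>n\<close> at position \<open>k\<close>. Only the entries with \<open>k \<le> n\<close> belong to the
  triangle; the recursion for those never leaves the triangle, and all other values
  are left \<open>undefined\<close>.\<close>

fun interp_triangle ::
  "real \<Rightarrow> real \<Rightarrow> real \<Rightarrow> real \<Rightarrow> real \<Rightarrow> real \<Rightarrow> nat \<Rightarrow> nat \<Rightarrow> real" where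
  "interp_triangle a0 a1 \<alpha> \<beta> u v n 0 = left_diagonal a0 a1 \<alpha> \<beta> n"
| "interp_triangle a0 a1 \<alpha> \<beta> u v n (Suc k) =
     (if Suc k \<le> n
      then u * interp_triangle a0 a1 \<alpha> \<beta> u v n k
         + v * interp_triangle a0 a1 \<alpha> \<beta> u v (n - 1) k
      else undefined)"

end

theory Submission
  imports Defs
begin

text \<open>With \<open>E\<close> the shift down a column, every column is annihilated by \<open>E\<^sup>2 - \<alpha> E - \<beta>\<close>, and
  \<open>c (k + 1)\<close>, \<open>c (k + 2)\<close> arise from the column of \<open>c k\<close> by applying \<open>F = E (u E + v)\<close> once and
  twice. Modulo \<open>E\<^sup>2 - \<alpha> E - \<beta>\<close> the operator \<open>F\<close> is \<open>(\<alpha> u + v) E + \<beta> u\<close>, whose trace and norm are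
  the coefficients of the claimed recurrence.\<close>

lemma interp_triangle_Suc_Suc:
  assumes "k \<le> n"
  shows "interp_triangle a0 a1 \<alpha> \<beta> u v (Suc n) (Suc k) =
    u * interp_triangle a0 a1 \<alpha> \<beta> u v (Suc n) k + v * interp_triangle a0 a1 \<alpha> \<beta> u v n k"
  using assms by simp

text \<open>The linear map from one column to the next commutes with the shift in \<open>n\<close>,
  so the recurrence of the left diagonal passes from column to column.\<close>

lemma interp_triangle_column_recurrence:
  assumes "k \<le> n"
  shows "interp_triangle a0 a1 \<alpha> \<beta> u v (Suc (Suc n)) k =
    \<alpha> * interp_triangle a0 a1 \<alpha> \<beta> u v (Suc n) k + \<beta> * interp_triangle a0 a1 \<alpha> \<beta> u v n k"
  using assms
proof (induction k arbitrary: n)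
  case 0
  then show ?case by simp
next
  case (Suc k)
  then obtain m where "n = Suc m" "k \<le> m"
    by (cases n) auto
  then show ?case
    using Suc.IH[of m] Suc.IH[of "Suc m"]
    by (simp add: interp_triangle_Suc_Suc algebra_simps del: interp_triangle.simps)
qed

lemma interp_triangle_diagonal_recurrence:
  fixes a0 a1 \<alpha> \<beta> u v :: real
  defines "T \<equiv> interp_triangle a0 a1 \<alpha> \<beta> u v"
  assumes "k \<le> n"
  shows "T (n + 4) (k + 2) = (\<alpha>\<^sup>2 * u + \<alpha> * v + 2 * \<beta> * u) * T (n + 2) (k + 1)
    - \<beta> * (u\<^sup>2 * \<beta> - u * v * \<alpha> - v\<^sup>2) * T n k"
proof -
  have step: "T (Suc m) (Suc j) = u * T (Suc m) j + v * T m j" if "j \<le> m" for m j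
    unfolding T_def using that by (rule interp_triangle_Suc_Suc)
  have column: "T (Suc (Suc m)) k = \<alpha> * T (Suc m) k + \<beta> * T m k" if "k \<le> m" for m
    unfolding T_def using that by (rule interp_triangle_column_recurrence)
  have "n + 4 = Suc (Suc (Suc (Suc n)))" "n + 2 = Suc (Suc n)"
    "k + 2 = Suc (Suc k)" "k + 1 = Suc k"
    by simp_all
  \<comment> \<open>\<open>step\<close> moves every entry into column \<open>k\<close>;
    \<open>column\<close> then reduces to rows \<open>n\<close> and \<open>n + 1\<close>, where the
    coefficients agree.\<close>
  then show ?thesis
    using \<open>k \<le> n\<close> by (simp only:) (simp add: step column algebra_simps power2_eq_square)
qed

theorem theorem10:
  fixes a0 a1 \<alpha> \<beta> u v \<B> :: real
    and l :: int and k0 :: nat and c :: "nat \<Rightarrow> real"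
  assumes "\<alpha> * \<beta> \<noteq> 0"
    and "u * v \<noteq> 0"
    and "\<bar>a0\<bar> + \<bar>a1\<bar> \<noteq> 0"
  defines "\<B> \<equiv> u\<^sup>2 * \<beta> - u * v * \<alpha> - v\<^sup>2"
    and "k0 \<equiv> (if l \<ge> 0 then 0 else nat \<bar>l\<bar>)"
    and "c \<equiv> (\<lambda>k. interp_triangle a0 a1 \<alpha> \<beta> u v (nat (2 * int k + l)) k)"
  shows "\<forall>k\<ge>k0. c (k + 2) =
           (\<alpha>\<^sup>2 * u + \<alpha> * v + 2 * \<beta> * u) * c (k + 1) - \<beta> * \<B> * c k"
proof (intro allI impI)
  fix k assume "k \<ge> k0"
  define n where "n = nat (2 * int k + l)"
  \<comment> \<open>The bound \<open>k0\<close> gives \<open>2 * int k + l \<ge> int k\<close>: the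
    entry lies in the triangle and \<open>nat\<close> truncates nothing.\<close>
  have "k \<le> n" "nat (2 * int (k + 1) + l) = n + 2" "nat (2 * int (k + 2) + l) = n + 4"
    using \<open>k \<ge> k0\<close> by (auto simp: n_def k0_def split: if_splits)
  then show "c (k + 2) = (\<alpha>\<^sup>2 * u + \<alpha> * v + 2 * \<beta> * u) * c (k + 1) - \<beta> * \<B> * c k"
    unfolding c_def \<B>_def n_def[symmetric]
    by (simp only: interp_triangle_diagonal_recurrence)
qed

end
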